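(* Let $x$ be the true solution of $\frac{d}{dt}x(t)=f(x(t),y(t);\lambda)$, $x(0)=x_0$, on $[0,T]$, where $f$ is Lipschitz in the state and in the input with constant $L>0$, and let $\kappa_n$ bound the local input approximation error: $\max_{s\in[t_n,t_n+h_n]}|y(s)-\tilde y(s)|\le\kappa_n$ for every $n$. Assume that $\Phi$ is Lipschitz with respect to its first argument with constant $L_\Phi>0$, i.e. $\|\Phi(z,u,\lambda,\tau)-\Phi(z',u,\lambda,\tau)\|\le L_\Phi\|z-z'\|$ for all $z,z',u,\lambda,\tau$, and that, for a given $\epsilon>0$, the residual network satisfies, at every step $n$ and for all $z\in\mathbb{R}^{n_x}$, $$\big\|[G-G_{\mathrm{approx}}](z,\tilde y^n_m,\lambda)(h_n)-G^{\epsilon}_{\theta^*}(z,\tilde y^n_m,\lambda)\big\|<\epsilon .$$ Let $\hat x(t_n)$ be generated by the residual DeepONet scheme $\hat x(t_{n+1})=G_{\mathrm{approx}}(\hat x(t_n),\tilde y^n_m,\lambda)(h_n)+G^{\epsilon}_{\theta^*}(\hat x(t_n),\tilde y^n_m,\lambda)$ with $\hat x(t_0)=x_0$. Then for any $t_n\in\mathcal{P}$ and step sizes $h_n\in(0,h]$, $$\|x(t_n)-\hat x(t_n)\|\le\frac{1-r^n}{1-r}\,\mathcal{E}+\frac{1-L_\Phi^n}{1-L_\Phi}\,\epsilon,$$ where $r:=e^{Lh}$ and $\mathcal{E}:=\max_n\{Lh_n\kappa_n e^{Lh_n}\}$.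
   Context: Let $T>0$, $h>0$, and let $\mathcal{P}$ be a partition $0=t_0<t_1<\dots<t_M=T$ with step sizes $h_n:=t_{n+1}-t_n\in(0,h]$, $n=0,\dots,M-1$; the maximum defining $\mathcal{E}$ is over these $n$. The input $y$ is one-dimensional and belongs to a compact set $V\subset C[0,T]$. On $[t_n,t_n+h_n]$ it is sampled at $m\ge1$ sensors, giving the vector $\tilde y^n_m=(y(t_n+d_0),\dots,y(t_n+d_{m-1}))\in\mathbb{R}^m$ with $d_k\in[0,h_n]$, from which a local approximation $\tilde y$ of $y$, continuous on that closed interval, is reconstructed by a rule determined by the sample vector and the step size (for $m=1$ it is the constant function given by the single sample). The approximations on consecutive intervals need not agree at the common endpoint. The parameter vector is $\lambda\in\mathbb{R}^{n_p}$. Let $f$ be a vector field with values in $\mathbb{R}^{n_x}$ depending on state, input and $\lambda$, satisfying $$\|f(x_1,y)-f(x_2,y)\|\le L\|x_1-x_2\|,\qquad\|f(x,y_1)-f(x,y_2)\|\le L|y_1-y_2|$$ for all arguments in the appropriate spaces ($\lambda$ suppressed), and let $f_{\mathrm{approx}}$ be a known vector field approximating $f$. For $z\in\mathbb{R}^{n_x}$, a sample vector $u\in\mathbb{R}^m$ with local input reconstruction $\tilde u$, and step $\tau\in(0,h]$, the local solution operators are $$G(z,u,\lambda)(\tau)=\xi(\tau),\quad \xi(t)=z+\int_0^t f(\xi(s),\tilde u(s);\lambda)\,ds,$$ $$G_{\mathrm{approx}}(z,u,\lambda)(\tau)=\eta(\tau),\quad \eta(t)=z+\int_0^t f_{\mathrm{approx}}(\eta(s),\tilde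 u(s);\lambda)\,ds,$$ both regarded as well defined for all $z\in\mathbb{R}^{n_x}$; the true solution $x$ is assumed to exist on $[0,T]$. The function $\Phi:\mathbb{R}^{n_x}\times\mathbb{R}^m\times\mathbb{R}^{n_p}\times\mathbb{R}\to\mathbb{R}^{n_x}$ is the one representing $G$: $G(z,u,\lambda)(\tau)=\Phi(z,u,\lambda,\tau)$. For each given step size $h_n$, the trained residual network is a one-hidden-layer network $$G^{\epsilon}_{\theta^*}(z,u,\lambda)=W_2\,\sigma\big(W_1\cdot\mathrm{col}(z,u,\lambda)+b_1\big)+b_2,$$ with $W_1\in\mathbb{R}^{K\times(n_x+m+n_p)}$, $b_1\in\mathbb{R}^K$, $W_2\in\mathbb{R}^{n_x\times K}$, $b_2\in\mathbb{R}^{n_x}$, where $\mathrm{col}$ stacks its arguments into one column vector and $\sigma$ is an activation function applied componentwise. When $L_\Phi=1$, the quotient $\frac{1-L_\Phi^n}{1-L_\Phi}$ is read as $\sum_{k=0}^{n-1}L_\Phi^k=n$. *)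

theory Defs
  imports "HOL-Analysis.Analysis"
begin

text \<open>
  The dimensions \<open>n\<^sub>x\<close>, \<open>m\<close>, \<open>n\<^sub>p\<close>, \<open>K\<close> are the cardinalities of the finite index
  types \<open>'n\<close>, \<open>'m\<close>, \<open>'p\<close>, \<open>'k\<close>.
\<close>

text \<open>
  \<open>C[0,T]\<close> with the uniform metric. Its points are extensional functions, i.e. they take
  the fixed value \<open>undefined\<close> outside \<open>[0,T]\<close>.
\<close>

definition cont_space :: "real \<Rightarrow> (real \<Rightarrow> real) metric" where
  "cont_space T = cfunspace (top_of_set {0..T}) euclidean_metric"

definition time_partition :: "(nat \<Rightarrow> real) \<Rightarrow> nat \<Rightarrow> real \<Rightarrow> bool" where
  "time_partition t M T \<longleftrightarrow> t 0 = 0 \<and> t M = T \<and> (\<forall>n<M. t n < t (Suc n))"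

definition step :: "(nat \<Rightarrow> real) \<Rightarrow> nat \<Rightarrow> real" where
  "step t n = t (Suc n) - t n"

text \<open>The sensor offsets \<open>d n k\<close> may depend on the step \<open>n\<close>.\<close>

definition samples ::
  "(real \<Rightarrow> real) \<Rightarrow> (nat \<Rightarrow> real) \<Rightarrow> (nat \<Rightarrow> 'm \<Rightarrow> real) \<Rightarrow> nat \<Rightarrow> real ^ 'm::finite" where
  "samples y t d n = (\<chi> k. y (t n + d n k))"

text \<open>
  A reconstruction rule \<open>R\<close> turns a sample vector \<open>u\<close> and a step size \<open>\<tau>\<close> into an input
  \<open>R u \<tau>\<close> in local time, of which only the values on \<open>[0,\<tau>]\<close> matter.
\<close>

definition reconstruction_rule ::
  "real \<Rightarrow> (real ^ 'm::finite \<Rightarrow> real \<Rightarrow> real \<Rightarrow> real) \<Rightarrow> bool" where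
  "reconstruction_rule h R \<longleftrightarrow>
     (\<forall>u \<tau>. 0 < \<tau> \<and> \<tau> \<le> h \<longrightarrow> continuous_on {0..\<tau>} (R u \<tau>)) \<and>
     (CARD('m) = 1 \<longrightarrow>
        (\<forall>u \<tau> k. 0 < \<tau> \<and> \<tau> \<le> h \<longrightarrow> (\<forall>s\<in>{0..\<tau>}. R u \<tau> s = u $ k)))"

text \<open>
  \<open>\<xi>\<close> solves \<open>\<xi>(t) = z + \<integral>\<^sub>0\<^sup>t F(\<xi>(s), w(s); \<lambda>) ds\<close> on \<open>[0,\<tau>]\<close>. No regularity of \<open>F\<close> is
  presupposed, so integrability of the right-hand side is part of being a solution.
\<close>

definition local_solution ::
  "(real ^ 'n \<Rightarrow> real \<Rightarrow> real ^ 'p \<Rightarrow> real ^ 'n) \<Rightarrow> (real \<Rightarrow> real) \<Rightarrow> real ^ 'p::finite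
     \<Rightarrow> real ^ 'n::finite \<Rightarrow> real \<Rightarrow> (real \<Rightarrow> real ^ 'n) \<Rightarrow> bool" where
  "local_solution F w l z \<tau> \<xi> \<longleftrightarrow>
     (\<lambda>s. F (\<xi> s) (w s) l) absolutely_integrable_on {0..\<tau>} \<and>
     (\<forall>t\<in>{0..\<tau>}. \<xi> t = z + integral {0..t} (\<lambda>s. F (\<xi> s) (w s) l))"

text \<open>
  The local solution operator \<open>G(z,u,\<lambda>)(\<tau>) = \<xi>(\<tau>)\<close> of the vector field \<open>F\<close>. Since the
  reconstruction depends on the step size, \<open>\<tau> \<mapsto> G(z,u,\<lambda>)(\<tau>)\<close> is in general not a
  trajectory.
\<close>

definition local_op ::
  "(real ^ 'n \<Rightarrow> real \<Rightarrow> real ^ 'p \<Rightarrow> real ^ 'n) \<Rightarrow> (real ^ 'm \<Rightarrow> real \<Rightarrow> real \<Rightarrow> real)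
     \<Rightarrow> real ^ 'n::finite \<Rightarrow> real ^ 'm::finite \<Rightarrow> real ^ 'p::finite \<Rightarrow> real \<Rightarrow> real ^ 'n" where
  "local_op F R z u l \<tau> = (THE v. \<exists>\<xi>. local_solution F (R u \<tau>) l z \<tau> \<xi> \<and> v = \<xi> \<tau>)"

definition local_op_well_defined ::
  "real \<Rightarrow> (real ^ 'n::finite \<Rightarrow> real \<Rightarrow> real ^ 'p::finite \<Rightarrow> real ^ 'n)
     \<Rightarrow> (real ^ 'm::finite \<Rightarrow> real \<Rightarrow> real \<Rightarrow> real) \<Rightarrow> bool" where
  "local_op_well_defined h F R \<longleftrightarrow>
     (\<forall>z u l \<tau>. 0 < \<tau> \<and> \<tau> \<le> h \<longrightarrow>
        (\<exists>!v. \<exists>\<xi>. local_solution F (R u \<tau>) l z \<tau> \<xi> \<and> v = \<xi> \<tau>))"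

definition col ::
  "real ^ 'n::finite \<Rightarrow> real ^ 'm::finite \<Rightarrow> real ^ 'p::finite \<Rightarrow> real ^ ('n + 'm + 'p)" where
  "col z u l = (\<chi> i. case i of Inl a \<Rightarrow> z $ a | Inr (Inl b) \<Rightarrow> u $ b | Inr (Inr c) \<Rightarrow> l $ c)"

definition residual_net ::
  "(real \<Rightarrow> real) \<Rightarrow> real ^ ('n + 'm + 'p) ^ 'k \<Rightarrow> real ^ 'k \<Rightarrow> real ^ 'k ^ 'n \<Rightarrow> real ^ 'n
     \<Rightarrow> real ^ 'n::finite \<Rightarrow> real ^ 'm::finite \<Rightarrow> real ^ 'p::finite \<Rightarrow> real ^ 'n" where
  "residual_net \<sigma> W1 b1 W2 (b2 :: real ^ 'n) z u l =
     W2 *v (\<chi> j::'k::finite. \<sigma> ((W1 *v col z u l + b1) $ j)) + b2"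

text \<open>
  The quotient \<open>(1 - q\<^sup>n) / (1 - q)\<close>, read as \<open>\<Sum>k<n. q\<^sup>k = n\<close> at \<open>q = 1\<close>, where the
  literal quotient would be \<open>0\<close>.
\<close>

definition geo_quot :: "real \<Rightarrow> nat \<Rightarrow> real" where
  "geo_quot q n = (if q = 1 then real n else (1 - q ^ n) / (1 - q))"

end

theory Submission
  imports Defs
begin

text \<open>
  The scheme \<open>z (Suc n) = G (z n)\<close> with the exact local operator separates the two error sources.
  On one step Gronwall's inequality compares \<open>z\<close> with the true solution, so that distance satisfies
  \<open>a (Suc n) \<le> r * a n + E\<close>. The distance from \<open>z\<close> to the network scheme satisfies
  \<open>a (Suc n) \<le> L\<^sub>\<Phi> * a n + \<epsilon>\<close>, because \<open>\<Phi>\<close> represents \<open>G\<close>. Both recursions sum to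
  geometric series.
\<close>

text \<open>The sum form absorbs the exceptional value \<open>q = 1\<close>, so the recursion below
  needs no case split.\<close>

lemma geo_quot_eq_sum: "geo_quot q n = (\<Sum>k<n. q ^ k)"
  by (simp add: geo_quot_def sum_gp_strict)

text \<open>Induction closes because multiplying the geometric sum of length \<open>n\<close> by
  \<open>q\<close> and adding 1 gives the sum of length \<open>Suc n\<close>. The bound
  \<open>n < M\<close> on the recursion matches a grid on which only \<open>M\<close> steps
  exist.\<close>

lemma affine_recursion_le_geo_quot:
  fixes a :: "nat \<Rightarrow> real"
  assumes "a 0 \<le> 0" and "q \<ge> 0" and rec: "\<And>n. n < M \<Longrightarrow> a (Suc n) \<le> q * a n + c"
    and "n \<le> M"
  shows "a n \<le> geo_quot q n * c"
  using \<open>n \<le> M\<close>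
proof (induction n)
  case 0
  then show ?case using assms by (simp add: geo_quot_eq_sum)
next
  case (Suc n)
  have "a (Suc n) \<le> q * a n + c"
    using rec Suc.prems by simp
  also have "\<dots> \<le> q * (geo_quot q n * c) + c"
    using Suc \<open>q \<ge> 0\<close> by (simp add: mult_left_mono)
  also have "\<dots> = geo_quot q (Suc n) * c"
    unfolding geo_quot_eq_sum sum.lessThan_Suc_shift
    by (simp add: sum_distrib_left algebra_simps)
  finally show ?case .
qed

text \<open>Write \<open>w\<close> for the right-hand side of the hypothesis. Since
  \<open>w' = L * u\<close> and \<open>u \<le> w\<close>, the integrating factor
  \<open>exp (- (L * s))\<close> turns \<open>w\<close> into a nonincreasing function.\<close>

lemma gronwall_integral:
  fixes u :: "real \<Rightarrow> real"
  assumes "0 \<le> \<tau>" and "0 \<le> L" and cont: "continuous_on {0..\<tau>} u"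
    and le: "\<And>s. s \<in> {0..\<tau>} \<Longrightarrow> u s \<le> c + L * integral {0..s} u"
  shows "u \<tau> \<le> c * exp (L * \<tau>)"
proof -
  define w where "w s = c + L * integral {0..s} u" for s
  define v where "v s = w s * exp (- (L * s))" for s
  have der: "(v has_real_derivative L * (u s - w s) * exp (- (L * s))) (at s within {0..\<tau>})"
    if "s \<in> {0..\<tau>}" for s
    unfolding v_def w_def
    by (rule derivative_eq_intros integral_has_real_derivative[OF cont] that refl)+
      (simp add: algebra_simps)
  have "v \<tau> \<le> v 0"
  proof (rule DERIV_nonpos_imp_decreasing_open[OF \<open>0 \<le> \<tau>\<close>])
    show "continuous_on {0..\<tau>} v"
      using der by (rule DERIV_continuous_on)
    fix s assume s: "0 < s" "s < \<tau>"
    have "(v has_real_derivative L * (u s - w s) * exp (- (L * s))) (at s)"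
      using der[of s] s by (simp add: at_within_Icc_at)
    moreover have "L * (u s - w s) * exp (- (L * s)) \<le> 0"
      using le[of s] s \<open>0 \<le> L\<close> by (auto simp: w_def mult_le_0_iff)
    ultimately show "\<exists>D. (v has_real_derivative D) (at s) \<and> D \<le> 0"
      by blast
  qed
  \<comment> \<open>Here \<open>v 0 = c\<close>, because the integral over a single point
    vanishes.\<close>
  then have "w \<tau> \<le> c * exp (L * \<tau>)"
    by (simp add: v_def w_def exp_minus field_simps)
  with le[of \<tau>] \<open>0 \<le> \<tau>\<close> show ?thesis
    by (simp add: w_def)
qed

lemma local_solution_continuous_on:
  assumes "local_solution F w l z \<tau> \<xi>"
  shows "continuous_on {0..\<tau>} \<xi>"
proof -
  have "(\<lambda>s. F (\<xi> s) (w s) l) integrable_on {0..\<tau>}"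
    using assms by (auto simp: local_solution_def absolutely_integrable_on_def)
  then have "continuous_on {0..\<tau>} (\<lambda>t. z + integral {0..t} (\<lambda>s. F (\<xi> s) (w s) l))"
    by (intro continuous_intros indefinite_integral_continuous_1)
  then show ?thesis
    by (rule continuous_on_eq) (use assms in \<open>auto simp: local_solution_def\<close>)
qed

text \<open>Well-definedness makes the endpoint value unique, so the description operator picks a
  value that some trajectory attains. That trajectory is what the integral estimates work
  on.\<close>

lemma local_op_solution:
  assumes "local_op_well_defined h F R" and "0 < \<tau>" and "\<tau> \<le> h"
  obtains \<xi> where "local_solution F (R u \<tau>) l z \<tau> \<xi>" and "local_op F R z u l \<tau> = \<xi> \<tau>"
proof -
  have "\<exists>!v. \<exists>\<xi>. local_solution F (R u \<tau>) l z \<tau> \<xi> \<and> v = \<xi> \<tau>"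
    using assms unfolding local_op_well_defined_def by blast
  from theI'[OF this] show thesis
    using that unfolding local_op_def by blast
qed

text \<open>Subtracting the two integral equations leaves an integrand bounded by
  \<open>L * u + L * \<kappa>\<close>. The input part integrates to at most
  \<open>L * \<kappa> * \<tau>\<close> and joins the initial distance as the constant in Gronwall's
  inequality.\<close>

lemma local_solution_perturbation_bound:
  fixes F :: "real ^ 'n::finite \<Rightarrow> real \<Rightarrow> real ^ 'p::finite \<Rightarrow> real ^ 'n"
  assumes "0 \<le> \<tau>" and "0 \<le> L"
    and lip_state: "\<And>z z' v. norm (F z v l - F z' v l) \<le> L * norm (z - z')"
    and lip_input: "\<And>z v v'. norm (F z v l - F z v' l) \<le> L * \<bar>v - v'\<bar>"
    and ode: "\<And>s. s \<in> {0..\<tau>} \<Longrightarrow>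
      (x has_vector_derivative F (x s) (y s) l) (at s within {0..\<tau>})"
    and sol: "local_solution F w l z \<tau> \<xi>"
    and input: "\<And>s. s \<in> {0..\<tau>} \<Longrightarrow> \<bar>y s - w s\<bar> \<le> \<kappa>"
  shows "norm (x \<tau> - \<xi> \<tau>) \<le> exp (L * \<tau>) * norm (x 0 - z) + L * \<tau> * \<kappa> * exp (L * \<tau>)"
proof -
  define u where "u s = norm (x s - \<xi> s)" for s
  have "0 \<le> \<kappa>"
    using input[of 0] \<open>0 \<le> \<tau>\<close> by simp
  have "continuous_on {0..\<tau>} x"
    using ode has_vector_derivative_continuous
    unfolding continuous_on_eq_continuous_within by blast
  then have cont: "continuous_on {0..\<tau>} u"
    unfolding u_def by (intro continuous_intros local_solution_continuous_on[OF sol])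
  have diff: "norm (F (x s) (y s) l - F (\<xi> s) (w s) l) \<le> L * u s + L * \<kappa>"
    if "s \<in> {0..\<tau>}" for s
  proof -
    \<comment> \<open>The mixed value \<open>F (\<xi> s) (y s) l\<close> changes the state first and
      the input second, so that each Lipschitz bound applies once.\<close>
    have "norm (F (x s) (y s) l - F (\<xi> s) (w s) l)
        \<le> norm (F (x s) (y s) l - F (\<xi> s) (y s) l) + norm (F (\<xi> s) (y s) l - F (\<xi> s) (w s) l)"
      by norm
    also have "\<dots> \<le> L * u s + L * \<bar>y s - w s\<bar>"
      unfolding u_def by (intro add_mono lip_state lip_input)
    also have "\<dots> \<le> L * u s + L * \<kappa>"
      using input[OF that] \<open>0 \<le> L\<close> by (simp add: mult_left_mono)
    finally show ?thesis .
  qed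
  have "u s \<le> (norm (x 0 - z) + L * \<kappa> * \<tau>) + L * integral {0..s} u" if s: "s \<in> {0..\<tau>}" for s
  proof -
    let ?g = "\<lambda>s. F (x s) (y s) l" and ?k = "\<lambda>s. F (\<xi> s) (w s) l"
    have sub: "{0..s} \<subseteq> {0..\<tau>}"
      using s by simp
    \<comment> \<open>Differentiability of \<open>x\<close> alone yields both the integrability of
      \<open>?g\<close> and its integral: this is the fundamental theorem for the Henstock-Kurzweil
      integral.\<close>
    have g: "(?g has_integral x s - x 0) {0..s}"
      using s sub
      by (intro fundamental_theorem_of_calculus)
        (auto intro!: has_vector_derivative_within_subset[OF ode sub])
    have "?k integrable_on {0..\<tau>}"
      using sol by (auto simp: local_solution_def absolutely_integrable_on_def)
    then have k: "?k integrable_on {0..s}"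
      using sub by (rule integrable_on_subinterval)
    have u_int: "u integrable_on {0..s}"
      using continuous_on_subset[OF cont sub] by (rule integrable_continuous_real)
    have "x s - \<xi> s = (x 0 - z) + integral {0..s} (\<lambda>s. ?g s - ?k s)"
      using sol s has_integral_integrable[OF g] k integral_unique[OF g]
      by (simp add: local_solution_def integral_diff)
    then have "u s \<le> norm (x 0 - z) + norm (integral {0..s} (\<lambda>s. ?g s - ?k s))"
      unfolding u_def by (simp only: norm_triangle_ineq)
    also have "norm (integral {0..s} (\<lambda>s. ?g s - ?k s)) \<le> integral {0..s} (\<lambda>s. L * u s + L * \<kappa>)"
    proof (rule integral_norm_bound_integral)
      show "(\<lambda>s. ?g s - ?k s) integrable_on {0..s}"
        using g k by (intro integrable_diff) (auto simp: has_integral_integrable)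
      show "(\<lambda>s. L * u s + L * \<kappa>) integrable_on {0..s}"
        using u_int by (intro integrable_add integrable_on_mult_right) auto
      show "norm (?g s' - ?k s') \<le> L * u s' + L * \<kappa>" if "s' \<in> {0..s}" for s'
        using that sub by (intro diff) auto
    qed
    also have "\<dots> = L * integral {0..s} u + L * \<kappa> * s"
      using s by (subst integral_add) (auto intro: integrable_on_mult_right u_int)
    \<comment> \<open>Gronwall's constant must not depend on \<open>s\<close>, so \<open>s\<close>
      is enlarged to \<open>\<tau>\<close>; this uses \<open>0 \<le> \<kappa>\<close>.\<close>
    also have "\<dots> \<le> L * integral {0..s} u + L * \<kappa> * \<tau>"
      using s \<open>0 \<le> L\<close> \<open>0 \<le> \<kappa>\<close> by (simp add: mult_left_mono)
    finally show ?thesis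
      by simp
  qed
  from gronwall_integral[OF \<open>0 \<le> \<tau>\<close> \<open>0 \<le> L\<close> cont this] show ?thesis
    by (simp add: u_def algebra_simps)
qed

theorem theorem4p4:
  fixes T h L L\<^sub>\<Phi> \<epsilon> :: real
    and M :: nat
    and t :: "nat \<Rightarrow> real"
    and V :: "(real \<Rightarrow> real) set"
    and y :: "real \<Rightarrow> real"
    and d :: "nat \<Rightarrow> 'm::finite \<Rightarrow> real"
    and R :: "real ^ 'm \<Rightarrow> real \<Rightarrow> real \<Rightarrow> real"
    and l :: "real ^ 'p::finite"
    and f f\<^sub>a :: "real ^ 'n::finite \<Rightarrow> real \<Rightarrow> real ^ 'p \<Rightarrow> real ^ 'n"
    and \<Phi> :: "real ^ 'n \<Rightarrow> real ^ 'm \<Rightarrow> real ^ 'p \<Rightarrow> real \<Rightarrow> real ^ 'n"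
    and x :: "real \<Rightarrow> real ^ 'n"
    and x0 :: "real ^ 'n"
    and \<kappa> :: "nat \<Rightarrow> real"
    and \<sigma> :: "real \<Rightarrow> real"
    and W1 :: "nat \<Rightarrow> real ^ ('n + 'm + 'p) ^ 'k::finite"
    and b1 :: "nat \<Rightarrow> real ^ 'k"
    and W2 :: "nat \<Rightarrow> real ^ 'k ^ 'n"
    and b2 :: "nat \<Rightarrow> real ^ 'n"
    and xhat :: "real \<Rightarrow> real ^ 'n"
  defines "r \<equiv> exp (L * h)"
    and "E \<equiv> Max ((\<lambda>n. L * step t n * \<kappa> n * exp (L * step t n)) ` {..<M})"
  assumes "T > 0" and "h > 0" and "L > 0" and "L\<^sub>\<Phi> > 0" and "\<epsilon> > 0"
    and partition: "time_partition t M T"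
    and step_le: "\<forall>n<M. step t n \<le> h"
    and V_compact: "compactin (mtopology_of (cont_space T)) V"
    and y_in: "y \<in> V"
    and sensors: "\<forall>n<M. \<forall>k. d n k \<in> {0..step t n}"
    and rule_R: "reconstruction_rule h R"
    and f_lipschitz_state: "\<forall>z z' v. norm (f z v l - f z' v l) \<le> L * norm (z - z')"
    and f_lipschitz_input: "\<forall>z v v'. norm (f z v l - f z v' l) \<le> L * \<bar>v - v'\<bar>"
    and G_well_defined: "local_op_well_defined h f R"
    and G_approx_well_defined: "local_op_well_defined h f\<^sub>a R"
    and x_init: "x 0 = x0"
    and x_ode: "\<forall>s\<in>{0..T}. (x has_vector_derivative f (x s) (y s) l) (at s within {0..T})"
    and input_error: "\<forall>n<M. \<forall>s\<in>{t n..t n + step t n}.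
           \<bar>y s - R (samples y t d n) (step t n) (s - t n)\<bar> \<le> \<kappa> n"
    and \<Phi>_represents: "\<forall>z u \<mu> \<tau>. 0 < \<tau> \<and> \<tau> \<le> h \<longrightarrow> local_op f R z u \<mu> \<tau> = \<Phi> z u \<mu> \<tau>"
    and \<Phi>_lipschitz: "\<forall>z z' u \<mu> \<tau>. norm (\<Phi> z u \<mu> \<tau> - \<Phi> z' u \<mu> \<tau>) \<le> L\<^sub>\<Phi> * norm (z - z')"
    and net_error: "\<forall>n<M. \<forall>z.
           norm (local_op f R z (samples y t d n) l (step t n)
                 - local_op f\<^sub>a R z (samples y t d n) l (step t n)
                 - residual_net \<sigma> (W1 n) (b1 n) (W2 n) (b2 n) z (samples y t d n) l) < \<epsilon>"
    and xhat_init: "xhat (t 0) = x0"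
    and xhat_step: "\<forall>n<M. xhat (t (Suc n)) =
           local_op f\<^sub>a R (xhat (t n)) (samples y t d n) l (step t n)
           + residual_net \<sigma> (W1 n) (b1 n) (W2 n) (b2 n) (xhat (t n)) (samples y t d n) l"
  shows "\<forall>n\<le>M. norm (x (t n) - xhat (t n)) \<le> (1 - r ^ n) / (1 - r) * E + geo_quot L\<^sub>\<Phi> n * \<epsilon>"
proof -
  have lt: "t n < t (Suc n)" if "n < M" for n
    using partition that by (auto simp: time_partition_def)
  have t_mono: "t i \<le> t j" if "i \<le> j" "j \<le> M" for i j
    using that
  proof (induction j rule: dec_induct)
    case (step k)
    then show ?case using lt[of k] by simp
  qed simp
  have step_pos: "0 < step t n" and t_Suc: "t (Suc n) = t n + step t n" if "n < M" for n
    using lt[OF that] by (simp_all add: step_def)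
  define G where "G n z = local_op f R z (samples y t d n) l (step t n)" for n z
  \<comment> \<open>\<open>rec_nat\<close> hands the index to \<open>G\<close>, so step
    \<open>n\<close> uses the samples and step size of the \<open>n\<close>-th interval.\<close>
  define zs where "zs = rec_nat x0 G"
  have zs_Suc: "zs (Suc n) = G n (zs n)" for n
    by (simp add: zs_def)
  have exact: "norm (x (t n) - zs n) \<le> geo_quot r n * E" if "n \<le> M" for n
  proof (rule affine_recursion_le_geo_quot[where M = M, OF _ _ _ that])
    show "norm (x (t 0) - zs 0) \<le> 0"
      using partition x_init by (simp add: zs_def time_partition_def)
    show "0 \<le> r"
      by (simp add: r_def)
    fix n assume n: "n < M"
    let ?\<tau> = "step t n"
    have in_T: "t n + s \<in> {0..T}" if "s \<in> {0..?\<tau>}" for s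
      using that t_mono[of 0 n] t_mono[of "Suc n" M] n t_Suc[OF n] partition
      by (auto simp: time_partition_def)
    obtain \<xi> where \<xi>: "local_solution f (R (samples y t d n) ?\<tau>) l (zs n) ?\<tau> \<xi>"
      and G_\<xi>: "G n (zs n) = \<xi> ?\<tau>"
      using local_op_solution[OF G_well_defined step_pos[OF n]] step_le n unfolding G_def
      by metis
    \<comment> \<open>The comparison runs in local time, with \<open>s\<close> in place of
      \<open>t n + s\<close>. Writing \<open>t n + 0\<close> lets the shifted trajectory match the
      lemma's \<open>x 0\<close>.\<close>
    have "norm (x (t n + ?\<tau>) - \<xi> ?\<tau>)
        \<le> exp (L * ?\<tau>) * norm (x (t n + 0) - zs n) + L * ?\<tau> * \<kappa> n * exp (L * ?\<tau>)"
    proof (rule local_solution_perturbation_bound[OF _ _ _ _ _ \<xi>])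
      show "0 \<le> ?\<tau>" "0 \<le> L"
        using step_pos[OF n] \<open>L > 0\<close> by auto
      show "\<And>z z' v. norm (f z v l - f z' v l) \<le> L * norm (z - z')"
        using f_lipschitz_state by blast
      show "\<And>z v v'. norm (f z v l - f z v' l) \<le> L * \<bar>v - v'\<bar>"
        using f_lipschitz_input by blast
      show "\<bar>y (t n + s) - R (samples y t d n) ?\<tau> s\<bar> \<le> \<kappa> n" if "s \<in> {0..?\<tau>}" for s
        using input_error[rule_format, OF n, of "t n + s"] that by simp
      fix s assume s: "s \<in> {0..?\<tau>}"
      \<comment> \<open>The derivative within \<open>{0..T}\<close> is restricted to the image of
        the local interval, so the chain rule for the shift also covers the endpoints.\<close>
      have "(x has_vector_derivative f (x (t n + s)) (y (t n + s)) l)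
          (at (t n + s) within (+) (t n) ` {0..?\<tau>})"
        using x_ode in_T s by (blast intro: has_vector_derivative_within_subset)
      moreover have "((+) (t n) has_vector_derivative 1) (at s within {0..?\<tau>})"
        by (auto intro!: derivative_eq_intros)
      ultimately have "(x \<circ> (+) (t n) has_vector_derivative 1 *\<^sub>R f (x (t n + s)) (y (t n + s)) l)
          (at s within {0..?\<tau>})"
        by (intro vector_diff_chain_within)
      then show "((\<lambda>s. x (t n + s)) has_vector_derivative f (x (t n + s)) (y (t n + s)) l)
          (at s within {0..?\<tau>})"
        by (simp add: o_def)
    qed
    \<comment> \<open>Only the growth factor is made uniform, by \<open>step t n \<le> h\<close>;
      the local error keeps its own exponent and is one of the values whose maximum is
      \<open>E\<close>.\<close>
    moreover have "exp (L * ?\<tau>) * norm (x (t n) - zs n) \<le> r * norm (x (t n) - zs n)"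
      using step_le n \<open>L > 0\<close> by (simp add: r_def mult_right_mono)
    moreover have "L * ?\<tau> * \<kappa> n * exp (L * ?\<tau>) \<le> E"
      using n by (auto simp: E_def intro!: Max_ge)
    ultimately show "norm (x (t (Suc n)) - zs (Suc n)) \<le> r * norm (x (t n) - zs n) + E"
      by (simp add: zs_Suc G_\<xi> t_Suc[OF n])
  qed
  have network: "norm (zs n - xhat (t n)) \<le> geo_quot L\<^sub>\<Phi> n * \<epsilon>" if "n \<le> M" for n
  proof (rule affine_recursion_le_geo_quot[where M = M, OF _ _ _ that])
    show "norm (zs 0 - xhat (t 0)) \<le> 0"
      using xhat_init by (simp add: zs_def)
    show "0 \<le> L\<^sub>\<Phi>"
      using \<open>L\<^sub>\<Phi> > 0\<close> by simp
    fix n assume n: "n < M"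
    have G_\<Phi>: "G n z = \<Phi> z (samples y t d n) l (step t n)" for z
      unfolding G_def using \<Phi>_represents step_pos[OF n] step_le n by blast
    \<comment> \<open>The intermediate point is the exact step from \<open>xhat (t n)\<close>. The
      old error is thus propagated by \<open>G\<close> alone, and the fresh error is the network
      error at \<open>xhat (t n)\<close>, which is covered because the network bound holds at every
      state.\<close>
    have "norm (G n (zs n) - G n (xhat (t n))) \<le> L\<^sub>\<Phi> * norm (zs n - xhat (t n))"
      unfolding G_\<Phi> using \<Phi>_lipschitz by blast
    moreover have "norm (G n (xhat (t n)) - xhat (t (Suc n))) \<le> \<epsilon>"
      using net_error[rule_format, OF n, of "xhat (t n)"] xhat_step n
      by (simp add: G_def diff_diff_eq)
    ultimately show "norm (zs (Suc n) - xhat (t (Suc n))) \<le> L\<^sub>\<Phi> * norm (zs n - xhat (t n)) + \<epsilon>"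
      unfolding zs_Suc by (rule norm_diff_triangle_le)
  qed
  \<comment> \<open>Since \<open>L * h > 0\<close>, the literal quotient in the first term of the
    bound is the geometric sum.\<close>
  have "r \<noteq> 1"
    using \<open>L > 0\<close> \<open>h > 0\<close> by (simp add: r_def)
  then have geo_r: "geo_quot r n = (1 - r ^ n) / (1 - r)" for n
    by (simp add: geo_quot_def)
  show ?thesis
  proof (intro allI impI)
    fix n assume "n \<le> M"
    have "norm (x (t n) - xhat (t n)) \<le> norm (x (t n) - zs n) + norm (zs n - xhat (t n))"
      by norm
    also have "\<dots> \<le> (1 - r ^ n) / (1 - r) * E + geo_quot L\<^sub>\<Phi> n * \<epsilon>"
      using exact[OF \<open>n \<le> M\<close>] network[OF \<open>n \<le> M\<close>] by (simp add: geo_r)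
    finally show "norm (x (t n) - xhat (t n)) \<le> (1 - r ^ n) / (1 - r) * E + geo_quot L\<^sub>\<Phi> n * \<epsilon>" .
  qed
qed

end
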